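(* Let $X\subseteq\mathbb R^d$ be closed and convex with nonempty interior. Let $\mathcal Q$ be a complete metric vector space of continuously differentiable functions from $X$ to $\mathbb R^d$ such that every $Q\in\mathcal Q$ has well-behaved projected dynamics (see context), so that it induces a dynamic solver $g_Q$. Assume: (1) $X$ has $C^2$ boundary; (2) for every $Q\in\mathcal Q$ there exist compact sets $K_1(Q)\subseteq X$ and $K_2(Q)\subseteq\partial X$ such that $\{x\in X:Q(x)=0\}\subseteq K_1(Q)$ and $\{x\in\partial X: Q^{\Pi}(x)=0\}\subseteq K_2(Q)$. Suppose there exists a finite-dimensional subspace $P\subseteq\mathcal Q$ such that, for every $Q\in\mathcal Q$, the maps $$e^{Q}:P\times X\to\mathbb R^d,\quad e^{Q}(p,x)=(Q+p)(x),$$ $$e^{\tilde Q}:P\times\partial X\times[0,\infty)\to\mathbb R^d,\quad e^{\tilde Q}(p,x,\alpha)=(Q+p)(x)-\alpha\, n(x)$$ are $C^1$ submersions, where $n:\partial X\to\mathbb R^d$ is the outward unit normal field. Then for prevalent $Q\in\mathcal Q$ there are finitely many reachable terminal outcomes: $|g_Q(X)|<\infty$.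
   Context: Tangent cone: $\operatorname{TC}_X(x)=\overline{\{\lambda(y-x): y\in X,\lambda\ge0\}}$, and $\Pi_{\operatorname{TC}_X(x)}$ is the Euclidean projection onto it. Projected vector field: $Q^{\Pi}(x):=\Pi_{\operatorname{TC}_X(x)}Q(x)$; when $X$ has $C^2$ boundary, for $x\in\partial X$ it equals $Q(x)-\langle Q(x),n(x)\rangle_+n(x)$ with $a_+=\max(a,0)$. A solution of the projected dynamics from $x_0\in X$ on an interval $I\ni 0$ in $[0,\infty)$ is an $X$-valued path, absolutely continuous on compact subintervals of $I$, with $x(0)=x_0$ and $\dot x(t)=Q^{\Pi}(x(t))$ for a.e. $t$. Well-behaved projected dynamics: there are a lower semicontinuous function $\tau:X\to(0,\infty]$ and a map $G:D\to X$, continuous on $D=\{(x_0,t)\in X\times[0,\infty): t<\tau(x_0)\}$, such that for each $x_0\in X$ the path $t\mapsto G(x_0,t)$ is a solution from $x_0$ on $[0,\tau(x_0))$, and is maximal: no solution in $X$ from $x_0$ extends it beyond $\tau(x_0)$, and any other solution from $x_0$ agrees with it on their common domain. Dynamic solver $g_Q:X\to X\sqcup\{\dagger\}$: $g_Q(x_0):=\lim_{t\to\infty}G(x_0,t)$ if $\tau(x_0)=\infty$ and the limit exists in $X$; otherwise $g_Q(x_0):=\dagger$, an extra point not in $X$. The set of reachable terminal outcomes is the image $g_Q(X)$. Prevalence: a subset $S\subseteq\mathcal Q$ is prevalent if there is a finite-dimensional subspace $P'\subseteq\mathcal Q$ such that for every $Q\in\mathcal Q$ the set $\{p\in P': Q+p\in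 S\}$ has full Lebesgue measure in $P'$. "For prevalent $Q$" means the set of $Q\in\mathcal Q$ with the stated property is prevalent. Submersion means the derivative is surjective at every point; $X$ and $\partial X\times[0,\infty)$ are regarded as manifolds with boundary. *)

theory Defs
  imports "HOL-Analysis.Analysis" "HOL-Library.Function_Algebras"
begin

section \<open>Function spaces\<close>

instantiation "fun" :: (type, real_vector) real_vector
begin

definition scaleR_fun :: "real \<Rightarrow> ('a \<Rightarrow> 'b) \<Rightarrow> 'a \<Rightarrow> 'b" where
  "scaleR_fun c f = (\<lambda>x. c *\<^sub>R f x)"

instance
  by standard (simp_all add: scaleR_fun_def fun_eq_iff scaleR_add_right scaleR_add_left)

end

text \<open>The metric lives on the carrier \<open>V\<close> and is not assumed to be translation invariant; only
  continuity of the vector space operations is required.\<close>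

definition complete_metric_vector_space ::
    "'v::real_vector set \<Rightarrow> ('v \<Rightarrow> 'v \<Rightarrow> real) \<Rightarrow> bool" where
  "complete_metric_vector_space V d \<longleftrightarrow>
     subspace V \<and> Metric_space V d \<and> Metric_space.mcomplete V d \<and>
     (let T = Metric_space.mtopology V d in
        continuous_map (prod_topology T T) T (\<lambda>(f, g). f + g) \<and>
        continuous_map (prod_topology euclideanreal T) T (\<lambda>(c, f). c *\<^sub>R f))"

definition fin_dim_subspace :: "'v::real_vector set \<Rightarrow> 'v set \<Rightarrow> bool" where
  "fin_dim_subspace P V \<longleftrightarrow> P \<subseteq> V \<and> (\<exists>B. finite B \<and> P = span B)"

text \<open>Lebesgue measure on \<open>P\<close> is the product Lebesgue measure in the coordinates given by a basis;
  its null sets do not depend on the basis. The set \<open>A\<close> need not be measurable: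
  its complement has to be contained in a null set.\<close>

definition full_lebesgue_measure_in :: "'v::real_vector set \<Rightarrow> 'v set \<Rightarrow> bool" where
  "full_lebesgue_measure_in P A \<longleftrightarrow>
     (\<exists>B. finite B \<and> independent B \<and> span B = P \<and>
          (AE c in Pi\<^sub>M B (\<lambda>_. lborel). (\<Sum>b\<in>B. c b *\<^sub>R b) \<in> A))"

definition prevalent_in :: "'v::real_vector set \<Rightarrow> 'v set \<Rightarrow> bool" where
  "prevalent_in V S \<longleftrightarrow>
     S \<subseteq> V \<and>
     (\<exists>P. fin_dim_subspace P V \<and>
          (\<forall>Q\<in>V. full_lebesgue_measure_in P {p \<in> P. Q + p \<in> S}))"

section \<open>Differentiability, smooth boundary, submersions\<close>

definition C1_on :: "'a::real_normed_vector set \<Rightarrow> ('a \<Rightarrow> 'b::real_normed_vector) \<Rightarrow> bool" where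
  "C1_on S f \<longleftrightarrow>
     (\<exists>f' :: 'a \<Rightarrow> 'a \<Rightarrow>\<^sub>L 'b.
        (\<forall>x\<in>S. (f has_derivative blinfun_apply (f' x)) (at x within S)) \<and> continuous_on S f')"

definition C2_on :: "'a::real_normed_vector set \<Rightarrow> ('a \<Rightarrow> 'b::real_normed_vector) \<Rightarrow> bool" where
  "C2_on S f \<longleftrightarrow>
     (\<exists>f' :: 'a \<Rightarrow> 'a \<Rightarrow>\<^sub>L 'b.
        (\<forall>x\<in>S. (f has_derivative blinfun_apply (f' x)) (at x within S)) \<and> C1_on S f')"

definition C2_defining_function ::
    "'a::euclidean_space set \<Rightarrow> 'a \<Rightarrow> 'a set \<Rightarrow> ('a \<Rightarrow> real) \<Rightarrow> bool" where
  "C2_defining_function X x U \<rho> \<longleftrightarrow>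
     open U \<and> x \<in> U \<and> C2_on U \<rho> \<and> (\<forall>y\<in>U. \<not> (\<rho> has_derivative (\<lambda>_. 0)) (at y)) \<and>
     X \<inter> U = {y \<in> U. \<rho> y \<le> 0}"

definition C2_boundary :: "'a::euclidean_space set \<Rightarrow> bool" where
  "C2_boundary X \<longleftrightarrow> (\<forall>x\<in>frontier X. \<exists>U \<rho>. C2_defining_function X x U \<rho>)"

text \<open>The vector \<open>v\<close> is the normalised gradient of a local defining function (with \<open>c\<close> the norm of
  the gradient).\<close>

definition outward_unit_normal :: "'a::euclidean_space set \<Rightarrow> 'a \<Rightarrow> 'a \<Rightarrow> bool" where
  "outward_unit_normal X x v \<longleftrightarrow>
     norm v = 1 \<and>
     (\<exists>U \<rho> c. C2_defining_function X x U \<rho> \<and> c > 0 \<and>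
              (\<rho> has_derivative (\<lambda>h. c * (v \<bullet> h))) (at x))"

text \<open>Here \<open>M\<close> is a manifold with boundary embedded in a normed space and \<open>T z\<close> is its tangent
  space at \<open>z\<close> (the full tangent space, also at boundary points). A derivative within \<open>M\<close> is
  determined on \<open>T z\<close> only, so surjectivity is required of its restriction to \<open>T z\<close>.\<close>

definition C1_submersion_on ::
    "'m::real_normed_vector set \<Rightarrow> ('m \<Rightarrow> 'm set) \<Rightarrow> ('m \<Rightarrow> 'b::real_normed_vector) \<Rightarrow> bool" where
  "C1_submersion_on M T f \<longleftrightarrow>
     (\<exists>f' :: 'm \<Rightarrow> 'm \<Rightarrow>\<^sub>L 'b.
        (\<forall>z\<in>M. (f has_derivative blinfun_apply (f' z)) (at z within M)) \<and> continuous_on M f' \<and>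
        (\<forall>z\<in>M. blinfun_apply (f' z) ` T z = UNIV))"

section \<open>Projected dynamics\<close>

definition tangent_cone :: "'a::euclidean_space set \<Rightarrow> 'a \<Rightarrow> 'a set" where
  "tangent_cone X x = closure {c *\<^sub>R (y - x) | c y. y \<in> X \<and> c \<ge> 0}"

definition projected_field :: "'a::euclidean_space set \<Rightarrow> ('a \<Rightarrow> 'a) \<Rightarrow> 'a \<Rightarrow> 'a" where
  "projected_field X Q x = closest_point (tangent_cone X x) (Q x)"

text \<open>The sets \<open>D\<close> are the finite families of non-overlapping compact subintervals of \<open>[a, b]\<close>.\<close>

definition abs_continuous_on_interval ::
    "real \<Rightarrow> real \<Rightarrow> (real \<Rightarrow> 'a::real_normed_vector) \<Rightarrow> bool" where
  "abs_continuous_on_interval a b f \<longleftrightarrow>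
     (\<forall>\<epsilon>>0. \<exists>\<delta>>0. \<forall>D. D division_of \<Union>D \<and> \<Union>D \<subseteq> {a..b} \<and> (\<Sum>K\<in>D. measure lborel K) < \<delta> \<longrightarrow>
        (\<Sum>K\<in>D. norm (f (Sup K) - f (Inf K))) < \<epsilon>)"

definition projected_solution ::
    "'a::euclidean_space set \<Rightarrow> ('a \<Rightarrow> 'a) \<Rightarrow> 'a \<Rightarrow> real set \<Rightarrow> (real \<Rightarrow> 'a) \<Rightarrow> bool" where
  "projected_solution X Q x0 I x \<longleftrightarrow>
     is_interval I \<and> 0 \<in> I \<and> I \<subseteq> {0..} \<and> x ` I \<subseteq> X \<and> x 0 = x0 \<and>
     (\<forall>a b. {a..b} \<subseteq> I \<longrightarrow> abs_continuous_on_interval a b x) \<and>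
     (AE t in lborel. t \<in> I \<longrightarrow>
        (x has_vector_derivative projected_field X Q (x t)) (at t within I))"

definition lifespan :: "('a \<Rightarrow> ereal) \<Rightarrow> 'a \<Rightarrow> real set" where
  "lifespan \<tau> x0 = {t. 0 \<le> t \<and> ereal t < \<tau> x0}"

definition well_behaved_flow ::
    "'a::euclidean_space set \<Rightarrow> ('a \<Rightarrow> 'a) \<Rightarrow> ('a \<Rightarrow> ereal) \<Rightarrow> ('a \<Rightarrow> real \<Rightarrow> 'a) \<Rightarrow> bool" where
  "well_behaved_flow X Q \<tau> G \<longleftrightarrow>
     (\<forall>x\<in>X. 0 < \<tau> x) \<and>
     (\<forall>x\<in>X. \<forall>c<\<tau> x. \<forall>\<^sub>F y in at x within X. c < \<tau> y) \<and>
     continuous_on (SIGMA x0:X. lifespan \<tau> x0) (\<lambda>(x0, t). G x0 t) \<and>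
     (\<forall>x0\<in>X.
        projected_solution X Q x0 (lifespan \<tau> x0) (G x0) \<and>
        \<not> (\<exists>I y. projected_solution X Q x0 I y \<and> lifespan \<tau> x0 \<subset> I \<and>
                 (\<forall>t\<in>lifespan \<tau> x0. y t = G x0 t)) \<and>
        (\<forall>I y. projected_solution X Q x0 I y \<longrightarrow> (\<forall>t\<in>I \<inter> lifespan \<tau> x0. y t = G x0 t)))"

text \<open>The extra outcome \<open>\<dagger>\<close> is \<^term>\<open>None\<close>. On \<open>X\<close>, the pair \<open>(\<tau>, G)\<close> is determined by \<open>Q\<close> (on the
  domain of the flow), hence so is the solver.\<close>

definition dynamic_solver ::
    "'a::euclidean_space set \<Rightarrow> ('a \<Rightarrow> ereal) \<Rightarrow> ('a \<Rightarrow> real \<Rightarrow> 'a) \<Rightarrow> 'a \<Rightarrow> 'a option" where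
  "dynamic_solver X \<tau> G x0 =
     (if \<tau> x0 = \<infinity> \<and> (\<exists>l\<in>X. (G x0 \<longlongrightarrow> l) at_top) then Some (Lim at_top (G x0)) else None)"

end

(*
A limit of a trajectory is an equilibrium of the projected dynamics, and an equilibrium x satisfies
either Q x = 0 or x in the boundary and Q x = alpha n(x) with alpha >= 0. Hence it is enough to show that
for almost every p in P the solution sets of these two equations for Q + p, which lie in compact sets, are
discrete. This is parametric transversality, proved without the implicit function theorem: let Z be the
set of zeros (p, y) of a submersion whose target has the dimension of the variable y. Countably many
pieces cover Z, each the graph of a Lipschitz map over a subset S of R^(dim P), and this map is
differentiable within S with derivative onto the kernel of the differential. The points of Z at which the partial derivative in y is
singular are critical points of the projection Z -> P, so their parameters form a null set by Sard's
theorem for arbitrary subsets and equal dimensions. No extension of the vector fields beyond X is needed,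
because the derivatives are only used within Z.
*)
theory Submission
  imports Defs
begin

section \<open>Parametric transversality\<close>

text \<open>The library states Sard's theorem for \<^typ>\<open>real^'n\<close> only; this index type transfers it to an
  arbitrary Euclidean space.\<close>

typedef (overloaded) 'a basis_index = "{..<DIM('a::euclidean_space)}"
  by (intro exI[of _ 0]) simp

text \<open>The order is carried over from the natural numbers because \<open>baby_Sard\<close> asks
  for index types that are finite and well-ordered.\<close>

instantiation basis_index :: (euclidean_space) linorder
begin

definition less_eq_basis_index :: "'a basis_index \<Rightarrow> 'a basis_index \<Rightarrow> bool" where
  "i \<le> j \<longleftrightarrow> Rep_basis_index i \<le> Rep_basis_index j"

definition less_basis_index :: "'a basis_index \<Rightarrow> 'a basis_index \<Rightarrow> bool" where
  "i < j \<longleftrightarrow> Rep_basis_index i < Rep_basis_index j"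

instance
  by standard (auto simp: less_eq_basis_index_def less_basis_index_def Rep_basis_index_inject)

end

instance basis_index :: (euclidean_space) wellorder
proof
  fix P :: "'a basis_index \<Rightarrow> bool" and i
  assume step: "\<And>i. (\<And>j. j < i \<Longrightarrow> P j) \<Longrightarrow> P i"
  show "P i"
    by (induction i rule: measure_induct_rule[of Rep_basis_index])
      (auto intro: step simp: less_basis_index_def)
qed

instance basis_index :: (euclidean_space) finite
proof
  have "(UNIV :: 'a basis_index set) = Abs_basis_index ` {..<DIM('a)}"
    by (rule type_definition.Abs_image[OF type_definition_basis_index, symmetric])
  then show "finite (UNIV :: 'a basis_index set)"
    by (metis finite_imageI finite_lessThan)
qed

lemma CARD_basis_index: "CARD('a::euclidean_space basis_index) = DIM('a)"
  using type_definition.card[OF type_definition_basis_index] by simp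

text \<open>Conjugation with a linear isomorphism \<open>u\<close> onto
  \<open>real^'p basis_index\<close> keeps the derivative singular, which there means rank below the
  dimension, so \<open>baby_Sard\<close> applies; the linear inverse \<open>v\<close> takes the null
  image back to a null set.\<close>

lemma negligible_image_singular_derivative:
  fixes f :: "'p::euclidean_space \<Rightarrow> 'p"
  assumes der: "\<And>x. x \<in> S \<Longrightarrow> (f has_derivative f' x) (at x within S)"
    and sing: "\<And>x. x \<in> S \<Longrightarrow> \<not> inj (f' x)"
  shows "negligible (f ` S)"
proof -
  have "DIM('p) = DIM(real^'p basis_index)"
    by (simp add: CARD_basis_index)
  then obtain u :: "'p \<Rightarrow> real^'p basis_index" and v
    where u: "linear u" and v: "linear v" and vu: "\<And>x. v (u x) = x" and uv: "\<And>y. u (v y) = y"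
    using isomorphisms_UNIV_UNIV by metis
  have bl: "bounded_linear u" "bounded_linear v"
    using u v by (simp_all add: linear_conv_bounded_linear)
  let ?g = "\<lambda>y. u (f (v y))" and ?g' = "\<lambda>y h. u (f' (v y) (v h))"
  have vS: "v ` u ` S = S"
    by (simp add: image_image vu)
  have der': "(?g has_derivative ?g' y) (at y within u ` S)" if y: "y \<in> u ` S" for y
  proof -
    have "v y \<in> S" using y vu by auto
    then have "(f has_derivative f' (v y)) (at (v y) within v ` u ` S)"
      unfolding vS by (rule der)
    then have "((\<lambda>y. f (v y)) has_derivative (\<lambda>h. f' (v y) (v h))) (at y within u ` S)"
      by (rule has_derivative_in_compose[OF bounded_linear_imp_has_derivative[OF bl(2)]])
    then show ?thesis
      by (rule bounded_linear.has_derivative[OF bl(1)])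
  qed
  have "rank (matrix (?g' y)) < CARD('p basis_index)" if y: "y \<in> u ` S" for y
  proof -
    have "v y \<in> S" using y vu by auto
    then obtain a b where ab: "a \<noteq> b" "f' (v y) a = f' (v y) b"
      using sing unfolding inj_def by blast
    then have "\<not> inj (?g' y)"
      unfolding inj_def using vu by metis
    moreover have "linear (?g' y)"
      using der'[OF y] has_derivative_linear by blast
    ultimately show ?thesis
      by (simp add: less_rank_noninjective matrix_works)
  qed
  with der' have "negligible (?g ` u ` S)"
    by (intro baby_Sard[where f' = ?g']) simp_all
  then have "negligible (v ` ?g ` u ` S)"
    by (rule negligible_differentiable_image_negligible[rotated])
      (simp_all add: CARD_basis_index linear_imp_differentiable_on v)
  moreover have "v ` ?g ` u ` S = f ` S"
    by (simp add: image_image vu)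
  ultimately show ?thesis by simp
qed

section \<open>Null sets of singular parameters\<close>

text \<open>By the Lipschitz bound, \<open>Y\<close> is the graph-like image of a map
  \<open>g\<close> inverse to \<open>\<pi>\<close>. With a left inverse \<open>H z\<close> of
  \<open>(A z, \<pi>)\<close> one has \<open>w - z = H z (A z (w - z), \<pi> w - \<pi> z)\<close>,
  and \<open>A z (w - z)\<close> is of smaller order because \<open>A z\<close> is a derivative of
  the zero function within \<open>Y\<close>. So \<open>g\<close> is differentiable, and Sard's
  theorem applies to \<open>fst\<close> after \<open>g\<close>, a map from \<open>'p\<close> to
  itself.\<close>

lemma negligible_fst_image_graph:
  fixes Y :: "('p::euclidean_space \<times> 'e::euclidean_space) set"
    and A :: "'p \<times> 'e \<Rightarrow> 'p \<times> 'e \<Rightarrow> 'b::euclidean_space"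
    and \<pi> :: "'p \<times> 'e \<Rightarrow> 'p"
  assumes \<pi>: "linear \<pi>" and k: "k > 0"
    and der: "\<And>z. z \<in> Y \<Longrightarrow> ((\<lambda>_. 0) has_derivative A z) (at z within Y)"
    and inj: "\<And>z. z \<in> Y \<Longrightarrow> inj (\<lambda>h. (A z h, \<pi> h))"
    and lip: "\<And>z w. z \<in> Y \<Longrightarrow> w \<in> Y \<Longrightarrow> norm (w - z) \<le> k * norm (\<pi> w - \<pi> z)"
    and sing: "\<And>z. z \<in> Y \<Longrightarrow> \<exists>v. v \<noteq> 0 \<and> A z (0, v) = 0"
  shows "negligible (fst ` Y)"
proof -
  define g where "g = inv_into Y \<pi>"
  have inj\<pi>: "inj_on \<pi> Y"
  proof (rule inj_onI)
    fix z w assume "z \<in> Y" "w \<in> Y" "\<pi> z = \<pi> w"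
    with lip[of z w] show "z = w" by simp
  qed
  have g\<pi>: "g (\<pi> z) = z" if "z \<in> Y" for z
    using that inj\<pi> by (simp add: g_def)
  have "\<exists>H. linear H \<and> (\<forall>h. H (A z h, \<pi> h) = h)" if zY: "z \<in> Y" for z
  proof -
    have "linear (\<lambda>h. (A z h, \<pi> h))"
      using has_derivative_linear[OF der[OF zY]] \<pi>
      by (simp add: linear_iff)
    then obtain H where "linear H" "H \<circ> (\<lambda>h. (A z h, \<pi> h)) = id"
      using linear_injective_left_inverse inj[OF zY] by blast
    then show ?thesis by (metis comp_def id_apply)
  qed
  then obtain H where H: "\<And>z. z \<in> Y \<Longrightarrow> linear (H z)"
    and HL: "\<And>z h. z \<in> Y \<Longrightarrow> H z (A z h, \<pi> h) = h"
    by metis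
  have g': "(g has_derivative (\<lambda>h. H (g s) (0, h))) (at s within \<pi> ` Y)" if sY: "s \<in> \<pi> ` Y" for s
  proof -
    obtain z where z: "z \<in> Y" and s: "s = \<pi> z" using sY by blast
    obtain M where M: "M > 0" "\<And>x. norm (H z x) \<le> M * norm x"
      using linear_bounded_pos[OF H[OF z]] by blast
    have blin: "bounded_linear (\<lambda>h. H z (0, h))"
      using H[OF z] bounded_linear_compose[of "H z" "\<lambda>h. (0, h)"]
      by (simp add: linear_conv_bounded_linear bounded_linear_Pair bounded_linear_zero
          bounded_linear_ident)
    have "\<exists>d>0. \<forall>t\<in>\<pi> ` Y. norm (t - s) < d \<longrightarrow>
        norm (g t - g s - H z (0, t - s)) \<le> e * norm (t - s)" if e: "e > 0" for e
    proof -
      \<comment> \<open>The factor \<open>M\<close> is lost in applying \<open>H z\<close> and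
        \<open>k\<close> in bounding \<open>w - z\<close> by \<open>t - s\<close>; both cancel and
        leave \<open>e\<close>.\<close>
      have "e / (M * k) > 0" using e M k by simp
      then obtain d where d: "d > 0"
        "\<And>w. w \<in> Y \<Longrightarrow> norm (w - z) < d \<Longrightarrow> norm (A z (w - z)) \<le> e / (M * k) * norm (w - z)"
        using der[OF z] unfolding has_derivative_within_alt
        by (metis diff_0 diff_zero norm_minus_cancel)
      \<comment> \<open>Points of the image within \<open>d / k\<close> of \<open>s\<close> come
        from points of \<open>Y\<close> within \<open>d\<close> of \<open>z\<close>.\<close>
      have "norm (g t - g s - H z (0, t - s)) \<le> e * norm (t - s)"
        if tY: "t \<in> \<pi> ` Y" and ts: "norm (t - s) < d / k" for t
      proof -
        obtain w where w: "w \<in> Y" and t: "t = \<pi> w" using tY by blast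
        have wz: "norm (w - z) \<le> k * norm (t - s)"
          using lip[OF z w] by (simp add: s t)
        also have "\<dots> < d"
          using ts k by (simp add: field_simps)
        finally have A: "norm (A z (w - z)) \<le> e / (M * k) * norm (w - z)"
          by (rule d(2)[OF w])
        have "w - z = H z (A z (w - z), t - s)"
          using HL[OF z, of "w - z"] linear_diff[OF \<pi>] by (simp add: s t)
        also have "\<dots> = H z (A z (w - z), 0) + H z (0, t - s)"
          using linear_add[OF H[OF z], of "(A z (w - z), 0)" "(0, t - s)"] by simp
        finally have "w - z - H z (0, t - s) = H z (A z (w - z), 0)"
          by (metis add_diff_cancel_right')
        then have "norm (g t - g s - H z (0, t - s)) = norm (H z (A z (w - z), 0))"
          using z w by (simp add: s t g\<pi>)
        also have "\<dots> \<le> M * norm (A z (w - z))"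
          using M(2)[of "(A z (w - z), 0)"] by (simp add: norm_Pair)
        also have "\<dots> \<le> M * (e / (M * k) * (k * norm (t - s)))"
          using A wz M k \<open>e > 0\<close>
          by (meson divide_nonneg_pos less_imp_le mult_left_mono mult_pos_pos order_trans)
        also have "\<dots> = e * norm (t - s)"
          using M k by simp
        finally show ?thesis .
      qed
      then show ?thesis
        using d k by (intro exI[of _ "d / k"]) auto
    qed
    then show ?thesis
      unfolding has_derivative_within_alt using blin z by (auto simp: s g\<pi>)
  qed
  have "negligible ((\<lambda>s. fst (g s)) ` \<pi> ` Y)"
  proof (rule negligible_image_singular_derivative)
    fix s assume s: "s \<in> \<pi> ` Y"
    show "((\<lambda>s. fst (g s)) has_derivative (\<lambda>h. fst (H (g s) (0, h)))) (at s within \<pi> ` Y)"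
      by (rule has_derivative_fst[OF g'[OF s]])
    have z: "g s \<in> Y" using s g\<pi> by auto
    obtain v where v: "v \<noteq> 0" "A (g s) (0, v) = 0" using sing[OF z] by blast
    \<comment> \<open>The kernel vector \<open>(0, v)\<close> is the derivative of \<open>g\<close>
      in the direction \<open>\<pi> (0, v)\<close>. Its first component vanishes, and the direction
      is nonzero since otherwise \<open>(0, v)\<close> would be zero.\<close>
    have "H (g s) (0, \<pi> (0, v)) = (0, v)"
      using HL[OF z, of "(0, v)"] v by simp
    moreover have "H (g s) (0, 0) = 0"
      using linear_0[OF H[OF z]] by (simp add: zero_prod_def)
    ultimately have "fst (H (g s) (0, \<pi> (0, v))) = fst (H (g s) (0, 0))" "\<pi> (0, v) \<noteq> 0"
      using v by (auto simp: zero_prod_def)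
    then show "\<not> inj (\<lambda>h. fst (H (g s) (0, h)))"
      unfolding inj_def by blast
  qed
  moreover have "(\<lambda>s. fst (g s)) ` \<pi> ` Y = fst ` Y"
    by (simp add: image_image g\<pi>)
  ultimately show ?thesis by simp
qed

text \<open>Closed balls in this finite-dimensional operator space are compact, hence have finite
  nets; the union of nets of mesh \<open>1 / Suc n\<close> in the balls of radius \<open>n\<close>
  is dense.\<close>

lemma blinfun_countable_dense:
  "\<exists>D :: ('a::euclidean_space \<Rightarrow>\<^sub>L 'b::euclidean_space) set.
     countable D \<and> (\<forall>f. \<forall>e>0. \<exists>g\<in>D. norm (f - g) < e)"
proof -
  have "\<exists>N::('a \<Rightarrow>\<^sub>L 'b) set. finite N \<and> cball 0 (real n) \<subseteq> (\<Union>g\<in>N. ball g (1 / Suc n))" for n :: nat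
    using seq_compact_imp_totally_bounded[OF compact_imp_seq_compact[OF compact_cball], of 0 "real n"]
    by (metis of_nat_0_less_iff zero_less_Suc zero_less_divide_1_iff)
  then obtain N :: "nat \<Rightarrow> ('a \<Rightarrow>\<^sub>L 'b) set" where N: "\<And>n. finite (N n)"
    "\<And>n. cball 0 (real n) \<subseteq> (\<Union>g\<in>N n. ball g (1 / Suc n))"
    by metis
  show ?thesis
  proof (intro exI[of _ "\<Union>n. N n"] conjI allI impI)
    show "countable (\<Union>n. N n)"
      using N by (auto intro: countable_finite)
    fix f :: "'a \<Rightarrow>\<^sub>L 'b" and e :: real assume e: "e > 0"
    obtain n where n: "norm f \<le> real n" "1 / e \<le> real n"
      using real_arch_simple[of "max (norm f) (1 / e)"] by auto
    then obtain g where g: "g \<in> N n" "dist g f < 1 / Suc n"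
      using N(2)[of n] by (auto simp: subset_iff)
    have "1 / Suc n < e"
      using n(2) e by (simp add: field_simps)
    then show "\<exists>g\<in>\<Union>n. N n. norm (f - g) < e"
      using g by (auto simp: dist_norm norm_minus_commute intro!: bexI[of _ g])
  qed
qed

text \<open>The kernel of \<open>A\<close> meets the range of a right inverse \<open>B\<close> only
  in 0, so its dimension is at most \<open>DIM('p)\<close>. A linear map \<open>\<pi>\<close> that
  is isometric on the kernel detects exactly what \<open>A\<close> misses.\<close>

lemma ex_linear_complement:
  fixes A :: "'p::euclidean_space \<times> 'e::euclidean_space \<Rightarrow> 'b::euclidean_space"
  assumes dims: "DIM('e) = DIM('b)" and A: "linear A" "surj A"
  obtains \<pi> :: "'p \<times> 'e \<Rightarrow> 'p" where "linear \<pi>" "inj (\<lambda>h. (A h, \<pi> h))"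
proof -
  let ?K = "{h. A h = 0}"
  obtain B where B: "linear B" "A \<circ> B = id"
    using linear_surjective_right_inverse[OF A] by blast
  then have AB: "A (B b) = b" for b by (metis comp_def id_apply)
  have injB: "inj B" by (metis AB injI)
  have K: "subspace ?K" by (rule linear_subspace_kernel[OF A(1)])
  have R: "subspace (range B)" by (rule linear_subspace_image[OF B(1) subspace_UNIV])
  have int: "?K \<inter> range B = {0}"
    using AB linear_0[OF B(1)] linear_0[OF A(1)] by force
  have "dim (range B) = DIM('b)"
    using dim_image_eq[OF B(1), of UNIV] injB by simp
  moreover have "dim {x + y |x y. x \<in> ?K \<and> y \<in> range B} + dim (?K \<inter> range B) = dim ?K + dim (range B)"
    by (rule dim_sums_Int[OF K R])
  moreover have "dim {x + y |x y. x \<in> ?K \<and> y \<in> range B} \<le> DIM('p \<times> 'e)"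
    by (rule dim_subset_UNIV)
  ultimately have "dim ?K \<le> dim (UNIV :: 'p set)"
    using dims int by simp
  then obtain \<pi> :: "'p \<times> 'e \<Rightarrow> 'p" where \<pi>: "linear \<pi>" "\<And>x. x \<in> ?K \<Longrightarrow> norm (\<pi> x) = norm x"
    using isometry_subset_subspace[OF K subspace_UNIV] by metis
  have lin: "linear (\<lambda>h. (A h, \<pi> h))"
    using A(1) \<pi>(1) by (simp add: linear_iff)
  have "inj (\<lambda>h. (A h, \<pi> h))"
    unfolding linear_injective_0[OF lin]
  proof (intro allI impI)
    fix h assume "(A h, \<pi> h) = 0"
    then have "A h = 0" "\<pi> h = 0" by (simp_all only: zero_prod_def prod.inject)
    with \<pi>(2)[of h] show "h = 0" by simp
  qed
  with \<pi>(1) show thesis by (rule that)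
qed

text \<open>The singular points are covered by countably many pieces to which
  \<open>negligible_fst_image_graph\<close> applies. A complementary projection exists at each point
  by \<open>ex_linear_complement\<close>, and a nearby member of a countable dense set still does
  the job.\<close>

lemma negligible_singular_parameters:
  fixes Z :: "('p::euclidean_space \<times> 'e::euclidean_space) set"
    and A :: "'p \<times> 'e \<Rightarrow> 'p \<times> 'e \<Rightarrow> 'b::euclidean_space"
  assumes dims: "DIM('e) = DIM('b)"
    and der: "\<And>z. z \<in> Z \<Longrightarrow> ((\<lambda>_. 0) has_derivative A z) (at z within Z)"
    and surj: "\<And>z. z \<in> Z \<Longrightarrow> surj (A z)"
  shows "negligible {p. \<exists>x v. (p, x) \<in> Z \<and> v \<noteq> 0 \<and> A (p, x) (0, v) = 0}"
proof -
  obtain D :: "(('p \<times> 'e) \<Rightarrow>\<^sub>L 'p) set"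
    where D: "countable D" "\<forall>f. \<forall>e>0. \<exists>g\<in>D. norm (f - g) < e"
    using blinfun_countable_dense by blast
  obtain C :: "('p \<times> 'e) set"
    where C: "countable C" "\<forall>X. open X \<longrightarrow> X \<noteq> {} \<longrightarrow> (\<exists>c\<in>C. c \<in> X)"
    using countable_dense_exists by blast
  \<comment> \<open>The conditions are, in order: injectivity of \<open>(A z, \<pi>)\<close> with a
    constant, a Lipschitz bound at scale \<open>1 / Suc k\<close>, confinement to a ball of half
    that radius, and singularity in the fibre direction.\<close>
  define Y where "Y = (\<lambda>(\<pi> :: ('p \<times> 'e) \<Rightarrow>\<^sub>L 'p) k c. {z \<in> Z.
      (\<forall>h. norm h \<le> real (Suc k) * (norm (A z h) + norm (blinfun_apply \<pi> h))) \<and>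
      (\<forall>w\<in>Z. norm (w - z) < 1 / Suc k \<longrightarrow> norm (w - z) \<le> Suc k * norm (blinfun_apply \<pi> (w - z))) \<and>
      z \<in> ball c (1 / (2 * Suc k)) \<and> (\<exists>v. v \<noteq> 0 \<and> A z (0, v) = 0)})"
  have neg: "negligible (fst ` Y \<pi> k c)" for \<pi> k c
  proof (rule negligible_fst_image_graph[where k = "Suc k" and A = A and \<pi> = "blinfun_apply \<pi>"])
    show "linear (blinfun_apply \<pi>)"
      by (simp add: blinfun.bounded_linear_right bounded_linear.linear)
    fix z assume z: "z \<in> Y \<pi> k c"
    then have zZ: "z \<in> Z" by (simp add: Y_def)
    show "((\<lambda>_. 0) has_derivative A z) (at z within Y \<pi> k c)"
      by (rule has_derivative_subset[OF der[OF zZ]]) (auto simp: Y_def)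
    have "linear (\<lambda>h. (A z h, blinfun_apply \<pi> h))"
      using has_derivative_linear[OF der[OF zZ]] by (simp add: linear_iff blinfun.bilinear_simps)
    then show "inj (\<lambda>h. (A z h, blinfun_apply \<pi> h))"
      unfolding linear_injective_0[OF \<open>linear (\<lambda>h. (A z h, blinfun_apply \<pi> h))\<close>]
    proof (intro allI impI)
      fix h assume "(A z h, blinfun_apply \<pi> h) = 0"
      then have "A z h = 0" "blinfun_apply \<pi> h = 0"
        by (simp_all only: zero_prod_def prod.inject)
      moreover have "norm h \<le> real (Suc k) * (norm (A z h) + norm (blinfun_apply \<pi> h))"
        using z unfolding Y_def by blast
      ultimately show "h = 0" by simp
    qed
    show "\<exists>v. v \<noteq> 0 \<and> A z (0, v) = 0"
      using z by (simp add: Y_def)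
    fix w assume w: "w \<in> Y \<pi> k c"
    \<comment> \<open>Two points of the ball of half radius are closer than
      \<open>1 / Suc k\<close>, so the bound required at \<open>z\<close> applies to
      \<open>w\<close>.\<close>
    have "dist w z \<le> dist c w + dist c z"
      by (metis dist_commute dist_triangle3)
    also have "\<dots> < 1 / (2 * Suc k) + 1 / (2 * Suc k)"
      using z w by (intro add_strict_mono) (simp_all add: Y_def)
    also have "\<dots> = 1 / Suc k"
      by (simp add: field_simps)
    finally show "norm (w - z) \<le> Suc k * norm (blinfun_apply \<pi> w - blinfun_apply \<pi> z)"
      using z w by (simp add: Y_def dist_norm blinfun.diff_right)
  qed simp
  have cover: "\<exists>\<pi>\<in>D. \<exists>k. \<exists>c\<in>C. z \<in> Y \<pi> k c"
    if z: "z \<in> Z" and sing: "\<exists>v. v \<noteq> 0 \<and> A z (0, v) = 0" for z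
  proof -
    have lin: "linear (A z)" by (rule has_derivative_linear[OF der[OF z]])
    obtain \<pi>0 :: "'p \<times> 'e \<Rightarrow> 'p" where \<pi>0: "linear \<pi>0" "inj (\<lambda>h. (A z h, \<pi>0 h))"
      using ex_linear_complement[OF dims lin surj[OF z]] by blast
    have "linear (\<lambda>h. (A z h, \<pi>0 h))"
      using lin \<pi>0(1) by (simp add: linear_iff)
    then obtain b where b: "b > 0" "\<And>h. b * norm h \<le> norm (A z h, \<pi>0 h)"
      using linear_inj_bounded_below_pos \<pi>0(2) by blast
    \<comment> \<open>Replacing \<open>\<pi>0\<close> by \<open>\<pi>\<close> costs at most half of
      the lower bound \<open>b\<close>.\<close>
    obtain \<pi> where \<pi>: "\<pi> \<in> D" "norm (Blinfun \<pi>0 - \<pi>) < b / 2"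
      using D(2)[rule_format, of "b / 2" "Blinfun \<pi>0"] b(1) by auto
    have low: "b / 2 * norm h \<le> norm (A z h) + norm (blinfun_apply \<pi> h)" for h
    proof -
      have "norm (\<pi>0 h - blinfun_apply \<pi> h) = norm (blinfun_apply (Blinfun \<pi>0 - \<pi>) h)"
        using \<pi>0(1) by (simp add: blinfun.diff_left bounded_linear_Blinfun_apply linear_conv_bounded_linear)
      also have "\<dots> \<le> b / 2 * norm h"
        using norm_blinfun[of "Blinfun \<pi>0 - \<pi>" h] \<pi>(2)
        by (meson less_imp_le mult_right_mono norm_ge_zero order_trans)
      finally have "norm (\<pi>0 h) \<le> norm (blinfun_apply \<pi> h) + b / 2 * norm h"
        using norm_triangle_sub[of "\<pi>0 h" "blinfun_apply \<pi> h"] by linarith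
      then show ?thesis
        using b(2)[of h] norm_Pair_le[of "A z h" "\<pi>0 h"] by (simp add: field_simps)
    qed
    \<comment> \<open>Near \<open>z\<close> the term \<open>A z (w - z)\<close> uses up
      \<open>b / 4\<close> of the remaining \<open>b / 2\<close>, so \<open>b / 4\<close> is left as
      a lower bound for \<open>\<pi>\<close> alone; \<open>k\<close> is then chosen so that
      \<open>Suc k\<close> exceeds both \<open>4 / b\<close> and \<open>1 / d\<close>.\<close>
    obtain d where d: "d > 0"
      "\<And>w. w \<in> Z \<Longrightarrow> norm (w - z) < d \<Longrightarrow> norm (A z (w - z)) \<le> b / 4 * norm (w - z)"
      using der[OF z] b(1) unfolding has_derivative_within_alt
      by (metis diff_0 diff_zero norm_minus_cancel zero_less_divide_iff zero_less_numeral)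
    obtain k :: nat where k: "4 / b \<le> real k" "1 / d \<le> real k"
      using real_arch_simple[of "max (4 / b) (1 / d)"] by auto
    have k': "1 \<le> real (Suc k) * (b / 4)" "1 / Suc k < d"
      using k b d by (simp_all add: field_simps)
    have *: "x \<le> real (Suc k) * y" if "b / 4 * x \<le> y" "0 \<le> x" for x y :: real
    proof -
      have "x \<le> real (Suc k) * (b / 4) * x"
        using mult_right_mono[OF k'(1) that(2)] by simp
      also have "\<dots> \<le> real (Suc k) * y"
        using mult_left_mono[OF that(1), of "real (Suc k)"] by (simp add: mult.assoc)
      finally show ?thesis .
    qed
    have "norm h \<le> real (Suc k) * (norm (A z h) + norm (blinfun_apply \<pi> h))" for h
      using low[of h] norm_ge_zero[of "A z h"] norm_ge_zero[of "blinfun_apply \<pi> h"]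
      by (intro *) (linarith, simp)
    moreover have "norm (w - z) \<le> Suc k * norm (blinfun_apply \<pi> (w - z))"
      if "w \<in> Z" "norm (w - z) < 1 / Suc k" for w
      using low[of "w - z"] d(2)[of w] that k'(2) by (intro *) auto
    moreover obtain c where "c \<in> C" "c \<in> ball z (1 / (2 * Suc k))"
      using C(2)[rule_format, of "ball z (1 / (2 * Suc k))"] by auto
    ultimately show ?thesis
      using \<pi>(1) z sing
      by (intro bexI[of _ \<pi>] exI[of _ k] bexI[of _ c]) (auto simp: Y_def dist_commute)
  qed
  have "negligible (\<Union>(\<pi>, k, c)\<in>D \<times> UNIV \<times> C. fst ` Y \<pi> k c)"
    using D(1) C(1) neg by (intro negligible_countable_Union) auto
  then show ?thesis
    by (rule negligible_subset) (use cover in force)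
qed

section \<open>Finiteness of compact zero sets\<close>

text \<open>An infinite compact \<open>T\<close> accumulates at one of its points \<open>x\<close>.
  For \<open>y\<close> in \<open>T\<close> near \<open>x\<close>, \<open>L x (y - x)\<close> is of
  smaller order than \<open>y - x\<close>, whereas an injective linear map is bounded below.\<close>

lemma finite_compact_regular_zeros:
  fixes T :: "'e::euclidean_space set" and L :: "'e \<Rightarrow> 'e \<Rightarrow> 'b::euclidean_space"
  assumes T: "compact T"
    and der: "\<And>x. x \<in> T \<Longrightarrow> ((\<lambda>_. 0) has_derivative L x) (at x within T)"
    and inj: "\<And>x. x \<in> T \<Longrightarrow> inj (L x)"
  shows "finite T"
proof (rule ccontr)
  assume "infinite T"
  then obtain x where x: "x \<in> T" "x islimpt T"
    using Heine_Borel_imp_Bolzano_Weierstrass[OF T] by blast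
  obtain b where b: "b > 0" "\<And>h. b * norm h \<le> norm (L x h)"
    using linear_inj_bounded_below_pos[OF has_derivative_linear[OF der[OF x(1)]] inj[OF x(1)]] by blast
  obtain d where d: "d > 0"
    "\<And>y. y \<in> T \<Longrightarrow> norm (y - x) < d \<Longrightarrow> norm (L x (y - x)) \<le> b / 2 * norm (y - x)"
    using der[OF x(1)] b(1) unfolding has_derivative_within_alt
    by (metis diff_0 diff_zero norm_minus_cancel half_gt_zero)
  obtain y where y: "y \<in> T" "y \<noteq> x" "dist y x < d"
    using x(2) d(1) unfolding islimpt_approachable by blast
  then have "b * norm (y - x) \<le> b / 2 * norm (y - x)"
    using b(2)[of "y - x"] d(2)[of y] by (simp add: dist_norm)
  then show False
    using b(1) y(2) by simp
qed

text \<open>Outside the null set of singular parameters, the derivative along the slice over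
  \<open>p\<close> is injective at each zero.\<close>

lemma generic_compact_slices_finite:
  fixes Z :: "('p::euclidean_space \<times> 'e::euclidean_space) set"
    and A :: "'p \<times> 'e \<Rightarrow> 'p \<times> 'e \<Rightarrow> 'b::euclidean_space"
  assumes dims: "DIM('e) = DIM('b)"
    and der: "\<And>z. z \<in> Z \<Longrightarrow> ((\<lambda>_. 0) has_derivative A z) (at z within Z)"
    and surj: "\<And>z. z \<in> Z \<Longrightarrow> surj (A z)"
  shows "\<exists>N. negligible N \<and> (\<forall>p T. p \<notin> N \<and> compact T \<and> {p} \<times> T \<subseteq> Z \<longrightarrow> finite T)"
proof -
  let ?N = "{p. \<exists>x v. (p, x) \<in> Z \<and> v \<noteq> 0 \<and> A (p, x) (0, v) = 0}"
  have "finite T" if p: "p \<notin> ?N" and T: "compact T" "{p} \<times> T \<subseteq> Z" for p T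
  proof -
    have der': "((\<lambda>_. 0) has_derivative (\<lambda>v. A (p, x) (0, v))) (at x within T)" if x: "x \<in> T" for x
    proof (rule has_derivative_in_compose[where f = "\<lambda>x. (p, x)" and g = "\<lambda>_. 0"])
      show "((\<lambda>_. 0) has_derivative A (p, x)) (at (p, x) within (\<lambda>x. (p, x)) ` T)"
        by (rule has_derivative_subset[OF der]) (use T(2) x in auto)
    qed (auto intro!: derivative_eq_intros)
    show ?thesis
    proof (rule finite_compact_regular_zeros[OF T(1) der'])
      fix x assume x: "x \<in> T"
      show "inj (\<lambda>v. A (p, x) (0, v))"
        unfolding linear_injective_0[OF has_derivative_linear[OF der'[OF x]]]
        using p T(2) x by blast
    qed
  qed
  moreover have "negligible ?N"
    using assms by (rule negligible_singular_parameters)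
  ultimately show ?thesis
    by (intro exI[of _ ?N] conjI allI impI) auto
qed

section \<open>Equilibria of the projected dynamics\<close>

lemma abs_continuous_on_interval_shift:
  assumes "abs_continuous_on_interval (t + a) (t + b) x"
  shows "abs_continuous_on_interval a b (\<lambda>s. x (t + s))"
  unfolding abs_continuous_on_interval_def
proof (intro allI impI)
  fix \<epsilon> :: real assume "\<epsilon> > 0"
  then obtain \<delta> where \<delta>: "\<delta> > 0"
    "\<And>D. D division_of \<Union>D \<Longrightarrow> \<Union>D \<subseteq> {t + a..t + b} \<Longrightarrow> (\<Sum>K\<in>D. measure lborel K) < \<delta> \<Longrightarrow>
      (\<Sum>K\<in>D. norm (x (Sup K) - x (Inf K))) < \<epsilon>"
    using assms unfolding abs_continuous_on_interval_def by metis
  have "(\<Sum>K\<in>D. norm (x (t + Sup K) - x (t + Inf K))) < \<epsilon>"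
    if D: "D division_of \<Union>D" "\<Union>D \<subseteq> {a..b}" "(\<Sum>K\<in>D. measure lborel K) < \<delta>" for D
  proof -
    let ?T = "\<lambda>K. (+) t ` K"
    have K: "\<exists>c d. c \<le> d \<and> K = {c..d}" if "K \<in> D" for K
      using division_ofD(3,4)[OF D(1) that] by (metis atLeastatMost_empty_iff cbox_interval)
    \<comment> \<open>Translation preserves lengths and moves endpoints by \<open>t\<close>, so the
      same \<open>\<delta>\<close> serves the translated division.\<close>
    have shift: "measure lborel (?T K) = measure lborel K \<and> Sup (?T K) = t + Sup K \<and> Inf (?T K) = t + Inf K"
      if "K \<in> D" for K
      using K[OF that] by auto
    have inj: "inj_on ?T D"
      by (rule inj_onI) (simp add: inj_image_eq_iff)
    have "(?T ` D) division_of \<Union>(?T ` D)"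
    proof (rule division_ofI)
      show "finite (?T ` D)" using D(1) by auto
      fix K assume "K \<in> ?T ` D"
      then obtain J where J: "J \<in> D" "K = ?T J" by blast
      then obtain c d where cd: "c \<le> d" "J = {c..d}" using K by blast
      show "K \<subseteq> \<Union>(?T ` D)" using J by blast
      show "K \<noteq> {}" using J cd by simp
      show "\<exists>c d. K = cbox c d" using J cd by auto
      fix K' assume "K' \<in> ?T ` D" "K \<noteq> K'"
      then obtain J' where J': "J' \<in> D" "K' = ?T J'" "J \<noteq> J'" using J by blast
      have "interior J \<inter> interior J' = {}"
        by (rule division_ofD(5)[OF D(1) J(1) J'(1,3)])
      then show "interior K \<inter> interior K' = {}"
        by (simp add: J J' interior_translation image_Int[symmetric])
    qed simp
    moreover have "\<Union>(?T ` D) \<subseteq> {t + a..t + b}"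
      using D(2) by fastforce
    moreover have "(\<Sum>K\<in>?T ` D. measure lborel K) < \<delta>"
      using D(3) by (simp add: sum.reindex[OF inj] shift)
    ultimately have "(\<Sum>K\<in>?T ` D. norm (x (Sup K) - x (Inf K))) < \<epsilon>"
      by (rule \<delta>(2))
    then show ?thesis
      by (simp add: sum.reindex[OF inj] shift)
  qed
  then show "\<exists>\<delta>>0. \<forall>D. D division_of \<Union>D \<and> \<Union>D \<subseteq> {a..b} \<and> (\<Sum>K\<in>D. measure lborel K) < \<delta> \<longrightarrow>
      (\<Sum>K\<in>D. norm (x (t + Sup K) - x (t + Inf K))) < \<epsilon>"
    using \<delta>(1) by (intro exI[of _ \<delta>] conjI allI impI) simp_all
qed

lemma projected_solution_shift:
  assumes sol: "projected_solution X Q x0 {0..} x" and t: "0 \<le> t"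
  shows "projected_solution X Q (x t) {0..} (\<lambda>s. x (t + s))"
  unfolding projected_solution_def
proof (intro conjI allI impI)
  show "(\<lambda>s. x (t + s)) ` {0..} \<subseteq> X"
    using sol t unfolding projected_solution_def by auto
  show "abs_continuous_on_interval a b (\<lambda>s. x (t + s))" if "{a..b} \<subseteq> {0..}" for a b
  proof -
    have "{t + a..t + b} \<subseteq> {0..}"
      using that t by auto
    then show ?thesis
      using sol unfolding projected_solution_def
      by (intro abs_continuous_on_interval_shift) blast
  qed
  \<comment> \<open>Translation invariance of Lebesgue measure turns the equation at almost every
    \<open>r\<close> into one at \<open>t + s\<close> for almost every \<open>s\<close>.\<close>
  have "AE r in distr lborel borel ((+) t).
      r \<in> {0..} \<longrightarrow> (x has_vector_derivative projected_field X Q (x r)) (at r within {0..})"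
    unfolding lborel_distr_plus using sol by (simp add: projected_solution_def)
  then have "AE s in lborel.
      t + s \<in> {0..} \<longrightarrow> (x has_vector_derivative projected_field X Q (x (t + s))) (at (t + s) within {0..})"
    by (rule AE_distrD[rotated]) simp
  then show "AE s in lborel. s \<in> {0..} \<longrightarrow>
      ((\<lambda>s. x (t + s)) has_vector_derivative projected_field X Q (x (t + s))) (at s within {0..})"
  proof eventually_elim
    case (elim s)
    show ?case
    proof
      assume s: "s \<in> {0..}"
      have "((+) t has_vector_derivative 1) (at s within {0..})"
        by (auto intro!: derivative_eq_intros)
      moreover have "(x has_vector_derivative projected_field X Q (x (t + s)))
          (at (t + s) within (+) t ` {0..})"
        using elim s t by (auto intro: has_vector_derivative_within_subset)
      ultimately have "(x \<circ> (+) t has_vector_derivative 1 *\<^sub>R projected_field X Q (x (t + s)))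
          (at s within {0..})"
        by (rule vector_diff_chain_within)
      then show "((\<lambda>s. x (t + s)) has_vector_derivative projected_field X Q (x (t + s))) (at s within {0..})"
        by (simp add: comp_def)
    qed
  qed
  show "is_interval {0::real..}"
    by (rule is_interval_ci)
qed simp_all

text \<open>On \<open>(0, c)\<close> the path has derivative 0, and almost everywhere also the fixed
  value \<open>projected_field X Q l\<close>. Were this value nonzero, the whole interval would be a
  null set.\<close>

lemma projected_field_zero_of_constant_solution:
  assumes sol: "projected_solution X Q l I x" and c: "0 < c" "{0..c} \<subseteq> I"
    and const: "\<And>t. t \<in> {0..c} \<Longrightarrow> x t = l"
  shows "projected_field X Q l = 0"
proof (rule ccontr)
  assume nz: "projected_field X Q l \<noteq> 0"
  have "AE t in lborel. t \<in> I \<longrightarrow> (x has_vector_derivative projected_field X Q (x t)) (at t within I)"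
    using sol by (simp add: projected_solution_def)
  then have "AE t in lborel. t \<notin> {0<..<c}"
  proof eventually_elim
    case (elim t)
    show ?case
    proof
      assume t: "t \<in> {0<..<c}"
      have sub: "{0<..<c} \<subseteq> I"
        using c(2) by (auto simp: subset_iff)
      with t have "t \<in> I"
        by blast
      with elim have "(x has_vector_derivative projected_field X Q (x t)) (at t within I)"
        by blast
      then have "(x has_vector_derivative projected_field X Q (x t)) (at t within {0<..<c})"
        using sub by (rule has_vector_derivative_within_subset)
      then have "(x has_vector_derivative projected_field X Q l) (at t)"
        unfolding has_vector_derivative_within_open[OF t open_greaterThanLessThan]
        by (subst (asm) const) (use t in auto)
      moreover have "(x has_vector_derivative 0) (at t)"
        by (rule has_vector_derivative_transform_within_open[OF has_vector_derivative_const[of l], of "{0<..<c}"])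
          (use t const in auto)
      ultimately show False
        using nz vector_derivative_unique_at by blast
    qed
  qed
  then have "emeasure lborel {0<..<c} = 0"
    by (subst (asm) AE_iff_measurable[of "{0<..<c}"]) auto
  then show False
    using c(1) by simp
qed

text \<open>The limit of a trajectory is a fixed point of the flow, because the shifted trajectory solves the
  dynamics as well and hence, by uniqueness, \<open>G (G x0 t) s = G x0 (t + s)\<close>.\<close>

lemma limit_is_equilibrium:
  assumes flow: "well_behaved_flow X Q \<tau> G" and x0: "x0 \<in> X" "\<tau> x0 = \<infinity>"
    and l: "l \<in> X" "(G x0 \<longlongrightarrow> l) at_top"
  shows "projected_field X Q l = 0"
proof -
  have life: "lifespan \<tau> x0 = {0..}"
    using x0 by (auto simp: lifespan_def)
  have sol: "projected_solution X Q x0 {0..} (G x0)"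
    using flow x0 unfolding well_behaved_flow_def life[symmetric] by blast
  have inX: "G x0 t \<in> X" if "0 \<le> t" for t
    using sol that unfolding projected_solution_def by auto
  have semigroup: "G x0 (t + s) = G (G x0 t) s" if "0 \<le> t" "s \<in> lifespan \<tau> (G x0 t)" for t s
  proof -
    have "\<forall>r\<in>{0..} \<inter> lifespan \<tau> (G x0 t). G x0 (t + r) = G (G x0 t) r"
      using flow inX[OF that(1)] projected_solution_shift[OF sol that(1)]
      unfolding well_behaved_flow_def by blast
    then show ?thesis
      using that by (auto simp: lifespan_def)
  qed
  have fixed: "G l s = l" if s: "s \<in> lifespan \<tau> l" for s
  proof -
    have s0: "0 \<le> s" "ereal s < \<tau> l"
      using s by (auto simp: lifespan_def)
    \<comment> \<open>Lower semicontinuity of \<open>\<tau>\<close> ensures that the flow from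
      \<open>G x0 t\<close> still exists at time \<open>s\<close> for late \<open>t\<close>. The
      filter leaves out \<open>l\<close> itself, where \<open>s < \<tau> l\<close> is known
      anyway.\<close>
    have "\<forall>\<^sub>F y in at l within X. ereal s < \<tau> y"
      using flow l(1) s0 unfolding well_behaved_flow_def by blast
    then obtain U where U: "open U" "l \<in> U" "\<And>y. y \<in> U \<Longrightarrow> y \<noteq> l \<Longrightarrow> y \<in> X \<Longrightarrow> ereal s < \<tau> y"
      unfolding eventually_at_topological by blast
    have "\<forall>\<^sub>F t in at_top. G x0 t \<in> U"
      using l(2) U(1,2) by (rule topological_tendstoD)
    then have ev: "\<forall>\<^sub>F t in at_top. 0 \<le> t \<and> s \<in> lifespan \<tau> (G x0 t)"
      using eventually_ge_at_top[of 0]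
      by eventually_elim (use U(3) inX s0 in \<open>auto simp: lifespan_def\<close>)
    have cont: "continuous_on (SIGMA x0:X. lifespan \<tau> x0) (\<lambda>(x0, t). G x0 t)"
      using flow by (simp add: well_behaved_flow_def)
    have "((\<lambda>t. (\<lambda>(x0, t). G x0 t) (G x0 t, s)) \<longlongrightarrow> (\<lambda>(x0, t). G x0 t) (l, s)) at_top"
    proof (rule continuous_on_tendsto_compose[OF cont])
      show "((\<lambda>t. (G x0 t, s)) \<longlongrightarrow> (l, s)) at_top"
        by (intro tendsto_intros l(2))
      show "(l, s) \<in> (SIGMA x0:X. lifespan \<tau> x0)"
        using l(1) s by simp
      show "\<forall>\<^sub>F t in at_top. (G x0 t, s) \<in> (SIGMA x0:X. lifespan \<tau> x0)"
        using ev by eventually_elim (simp add: inX)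
    qed
    then have "((\<lambda>t. G (G x0 t) s) \<longlongrightarrow> G l s) at_top"
      by simp
    \<comment> \<open>By the semigroup law these are later points of the same trajectory, so
      comparison with the limit given by continuity of the flow yields
      \<open>G l s = l\<close>.\<close>
    moreover have "((\<lambda>t. G (G x0 t) s) \<longlongrightarrow> l) at_top"
    proof (rule Lim_transform_eventually)
      show "((\<lambda>t. G x0 (t + s)) \<longlongrightarrow> l) at_top"
        by (rule filterlim_compose[OF l(2)])
          (rule filterlim_at_top_mono[OF filterlim_ident], use s0 in \<open>auto intro: always_eventually\<close>)
      show "\<forall>\<^sub>F t in at_top. G x0 (t + s) = G (G x0 t) s"
        using ev by eventually_elim (simp add: semigroup)
    qed
    ultimately show ?thesis
      using tendsto_unique trivial_limit_at_top_linorder by blast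
  qed
  have "0 < \<tau> l"
    using flow l(1) by (simp add: well_behaved_flow_def)
  then obtain c where c: "0 < c" "ereal c < \<tau> l"
    using ereal_dense2[of 0 "\<tau> l"] by auto
  have sub: "{0..c} \<subseteq> lifespan \<tau> l"
    using c(2) by (auto simp: lifespan_def intro: le_less_trans[rotated])
  have "projected_solution X Q l (lifespan \<tau> l) (G l)"
    using flow l(1) by (simp add: well_behaved_flow_def)
  then show ?thesis
    using c(1) sub by (rule projected_field_zero_of_constant_solution) (use fixed sub in blast)
qed

section \<open>Tangent cones and normals of the boundary\<close>

lemma projected_field_interior:
  assumes x: "x \<in> interior X"
  shows "projected_field X q x = q x"
proof -
  obtain e where e: "e > 0" "ball x e \<subseteq> X"
    using x unfolding mem_interior by blast
  \<comment> \<open>The summand 1 keeps \<open>m\<close> positive when \<open>q x = 0\<close>. A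
    small positive step along \<open>q x\<close> stays in \<open>X\<close>, so \<open>q x\<close>
    lies in the tangent cone and the projection fixes it.\<close>
  define m where "m = norm (q x) + 1"
  have m: "m > 0" "norm (q x) \<le> m"
    by (simp_all add: m_def add_nonneg_pos)
  define t where "t = e / m / 2"
  have t: "t > 0"
    using e(1) m by (simp add: t_def)
  have "t * norm (q x) \<le> t * m"
    using t m by (intro mult_left_mono) auto
  also have "\<dots> = e / 2"
    using m by (simp add: t_def)
  also have "\<dots> < e"
    using e(1) by simp
  finally have "t * norm (q x) < e" .
  then have "x + t *\<^sub>R q x \<in> X"
    using e(2) t by (auto simp: dist_norm subset_iff)
  moreover have "q x = (1 / t) *\<^sub>R ((x + t *\<^sub>R q x) - x)"
    using t by simp
  ultimately have "q x \<in> {c *\<^sub>R (y - x) | c y. y \<in> X \<and> c \<ge> 0}"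
    using t by (smt (verit) mem_Collect_eq zero_le_divide_1_iff)
  then have "q x \<in> tangent_cone X x"
    unfolding tangent_cone_def by (rule subsetD[OF closure_subset])
  then show ?thesis
    unfolding projected_field_def by (rule closest_point_self)
qed

text \<open>Along such a direction the defining function has negative derivative, so short steps
  from \<open>x\<close> stay in its sublevel set and hence in \<open>X\<close>.\<close>

lemma inward_in_tangent_cone:
  assumes normal: "outward_unit_normal X x n" and x: "x \<in> X" and v: "v \<bullet> n < 0"
  shows "v \<in> tangent_cone X x"
proof -
  obtain U \<rho> c where U: "open U" "x \<in> U" "X \<inter> U = {y \<in> U. \<rho> y \<le> 0}"
    and c: "c > 0" "(\<rho> has_derivative (\<lambda>h. c * (n \<bullet> h))) (at x)"
    using normal unfolding outward_unit_normal_def C2_defining_function_def by blast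
  have path: "((\<lambda>t. x + t *\<^sub>R v) has_derivative (\<lambda>t. t *\<^sub>R v)) (at 0)"
    by (auto intro!: derivative_eq_intros)
  have "((\<lambda>t. \<rho> (x + t *\<^sub>R v)) has_derivative (\<lambda>t. c * (n \<bullet> (t *\<^sub>R v)))) (at 0)"
    by (rule has_derivative_compose[OF path]) (simp add: c(2))
  then have "((\<lambda>t. \<rho> (x + t *\<^sub>R v)) has_real_derivative c * (n \<bullet> v)) (at 0)"
    unfolding has_field_derivative_def
    by (rule has_derivative_eq_rhs) (simp add: fun_eq_iff mult.commute mult.left_commute)
  moreover have "c * (n \<bullet> v) < 0"
    using c(1) v by (simp add: inner_commute mult_pos_neg)
  ultimately obtain d where d: "d > 0" "\<And>h. 0 < h \<Longrightarrow> h < d \<Longrightarrow> \<rho> (x + h *\<^sub>R v) < \<rho> x"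
    using DERIV_neg_dec_right[of "\<lambda>t. \<rho> (x + t *\<^sub>R v)" "c * (n \<bullet> v)" 0] by auto
  have "((\<lambda>t. x + t *\<^sub>R v) \<longlongrightarrow> x + 0 *\<^sub>R v) (at_right 0)"
    by (intro tendsto_intros)
  then have "\<forall>\<^sub>F t in at_right 0. x + t *\<^sub>R v \<in> U"
    using U(1,2) by (auto intro: topological_tendstoD)
  moreover have "\<forall>\<^sub>F t in at_right (0::real). 0 < t \<and> t < d"
    using d(1) unfolding eventually_at_right_field by blast
  ultimately have "\<forall>\<^sub>F t in at_right (0::real). x + t *\<^sub>R v \<in> U \<and> 0 < t \<and> t < d"
    by eventually_elim simp
  then obtain t where t: "x + t *\<^sub>R v \<in> U" "0 < t" "t < d"
    using eventually_happens' trivial_limit_at_right_real by blast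
  have "\<rho> x \<le> 0"
    using U x by blast
  then have "x + t *\<^sub>R v \<in> X"
    using t d(2)[of t] U(3) by force
  moreover have "v = (1 / t) *\<^sub>R ((x + t *\<^sub>R v) - x)"
    using t by simp
  ultimately have "v \<in> {c *\<^sub>R (y - x) | c y. y \<in> X \<and> c \<ge> 0}"
    using t by (smt (verit) mem_Collect_eq zero_le_divide_1_iff)
  then show ?thesis
    unfolding tangent_cone_def by (rule subsetD[OF closure_subset])
qed

text \<open>If 0 is a nearest point of the tangent cone to \<open>q x\<close>, then
  \<open>q x\<close> makes no acute angle with an inward direction. The polar cone of the open
  inward half-space is the ray through \<open>n\<close>.\<close>

lemma frontier_equilibrium_normal:
  assumes normal: "outward_unit_normal X x n" and x: "x \<in> X"
    and zero: "projected_field X q x = 0"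
  shows "q x = norm (q x) *\<^sub>R n"
proof -
  have n: "n \<bullet> n = 1"
    using normal by (simp add: outward_unit_normal_def dot_square_norm)
  have polar: "q x \<bullet> v \<le> 0" if v: "v \<bullet> n < 0" for v
  proof (rule ccontr)
    assume "\<not> q x \<bullet> v \<le> 0"
    then have pos: "q x \<bullet> v > 0" by simp
    then have vv: "v \<bullet> v > 0" by (metis inner_gt_zero_iff inner_zero_right less_irrefl)
    \<comment> \<open>This \<open>s\<close> minimises the distance from \<open>q x\<close> to the
      line through \<open>v\<close>; it would give a point of the cone closer to \<open>q x\<close>
      than 0.\<close>
    define s where "s = (q x \<bullet> v) / (v \<bullet> v)"
    have s: "s > 0" using pos vv by (simp add: s_def)
    have "s *\<^sub>R v \<in> tangent_cone X x"
      using inward_in_tangent_cone[OF normal x] v s by (simp add: mult_pos_neg)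
    then have "dist (q x) 0 \<le> dist (q x) (s *\<^sub>R v)"
      using closest_point_le[of "tangent_cone X x" "s *\<^sub>R v" "q x"] zero
      by (simp add: projected_field_def tangent_cone_def)
    then have "(norm (q x))\<^sup>2 \<le> (norm (q x - s *\<^sub>R v))\<^sup>2"
      by (simp add: dist_norm)
    then have "0 \<le> s * (s * (v \<bullet> v)) - 2 * s * (q x \<bullet> v)"
      by (simp add: power2_norm_eq_inner inner_diff_left inner_diff_right inner_commute)
    also have "s * (v \<bullet> v) = q x \<bullet> v"
      using vv by (simp add: s_def)
    finally show False
      using mult_pos_pos[OF s pos] by simp
  qed
  \<comment> \<open>The tangential part \<open>w\<close> is not strictly inward, so the polar
    inequality is tested on \<open>w - e *\<^sub>R n\<close> and \<open>e\<close> tends to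
    0.\<close>
  define w where "w = q x - (q x \<bullet> n) *\<^sub>R n"
  have wn: "w \<bullet> n = 0"
    by (simp add: w_def inner_diff_left n)
  have qw: "q x \<bullet> w = w \<bullet> w"
    using wn by (simp add: w_def inner_diff_left inner_diff_right inner_commute)
  have ge: "q x \<bullet> n \<ge> 0"
    using polar[of "- n"] n by simp
  have le: "w \<bullet> w \<le> e * (q x \<bullet> n)" if "e > 0" for e
    using polar[of "w - e *\<^sub>R n"] that by (simp add: inner_diff_left inner_diff_right wn n qw)
  have "((\<lambda>e. e * (q x \<bullet> n)) \<longlongrightarrow> 0 * (q x \<bullet> n)) (at_right 0)"
    by (intro tendsto_intros)
  then have "w \<bullet> w \<le> 0 * (q x \<bullet> n)"
    by (rule tendsto_lowerbound) (auto simp: eventually_at_right_less le intro: eventually_mono[OF eventually_at_right_less])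
  then have "w \<bullet> w = 0"
    using inner_ge_zero[of w] by simp
  then have "w = 0"
    by simp
  then have "q x = (q x \<bullet> n) *\<^sub>R n"
    by (simp add: w_def)
  then show ?thesis
    using ge normal by (metis abs_of_nonneg mult.right_neutral norm_scaleR outward_unit_normal_def)
qed

text \<open>Near \<open>x\<close> the defining function vanishes on the frontier, since a negative
  value would put a neighbourhood inside \<open>X\<close>. Its derivative, divided by
  \<open>c\<close>, is therefore a derivative of the zero function within the frontier.\<close>

lemma has_derivative_normal_frontier:
  assumes normal: "outward_unit_normal X x n" and X: "closed X" and x: "x \<in> frontier X"
  shows "((\<lambda>_. 0) has_derivative (\<lambda>h. n \<bullet> h)) (at x within frontier X)"
proof -
  obtain U \<rho> c where U: "open U" "x \<in> U" "X \<inter> U = {y \<in> U. \<rho> y \<le> 0}" "C2_on U \<rho>"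
    and c: "c > 0" "(\<rho> has_derivative (\<lambda>h. c * (n \<bullet> h))) (at x)"
    using normal unfolding outward_unit_normal_def C2_defining_function_def by blast
  obtain e where e: "e > 0" "ball x e \<subseteq> U"
    using U(1,2) open_contains_ball by blast
  obtain \<rho>' where \<rho>': "\<forall>y\<in>U. (\<rho> has_derivative blinfun_apply (\<rho>' y)) (at y within U)"
    using U(4) unfolding C2_on_def by blast
  then have cont: "continuous_on U \<rho>"
    by (intro has_derivative_continuous_on[of U \<rho> "\<lambda>y. blinfun_apply (\<rho>' y)"]) blast
  have zero: "\<rho> y = 0" if y: "y \<in> frontier X" "y \<in> U" for y
  proof (rule antisym)
    have "y \<in> X" using y(1) X frontier_subset_eq by blast
    then show "\<rho> y \<le> 0" using U(3) y(2) by blast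
    show "\<rho> y \<ge> 0"
    proof (rule ccontr)
      assume neg: "\<not> \<rho> y \<ge> 0"
      have "open (U \<inter> \<rho> -` {..<0})"
        by (rule continuous_open_preimage[OF cont U(1) open_lessThan])
      moreover have "U \<inter> \<rho> -` {..<0} \<subseteq> X"
        using U(3) by force
      ultimately have "y \<in> interior X"
        using neg y(2) by (intro interiorI) auto
      then show False
        using y(1) by (simp add: frontier_def)
    qed
  qed
  have "(\<rho> has_derivative (\<lambda>h. c * (n \<bullet> h))) (at x within frontier X)"
    using c(2) has_derivative_at_withinI by blast
  then have "((\<lambda>_. 0) has_derivative (\<lambda>h. c * (n \<bullet> h))) (at x within frontier X)"
    by (rule has_derivative_transform_within[OF _ e(1) x])
      (use zero e(2) in \<open>auto simp: subset_iff dist_commute\<close>)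
  then have "((\<lambda>_. (1 / c) *\<^sub>R 0) has_derivative (\<lambda>h. (1 / c) *\<^sub>R (c * (n \<bullet> h)))) (at x within frontier X)"
    by (rule has_derivative_scaleR_right)
  then show ?thesis
    using c(1) by simp
qed

section \<open>Prevalence\<close>

text \<open>Lebesgue measure is determined by its values on boxes, and the preimage of a box is a
  product of intervals. The index set is the image of \<open>Basis\<close>, since the measure on
  \<open>P\<close> is defined through a basis of \<open>P\<close>.\<close>

lemma distr_PiM_lborel_coordinates:
  fixes \<iota> :: "'p::euclidean_space \<Rightarrow> 'v"
  assumes inj: "inj_on \<iota> Basis"
  shows "distr (Pi\<^sub>M (\<iota> ` Basis) (\<lambda>_. lborel)) borel (\<lambda>c. \<Sum>i\<in>Basis. c (\<iota> i) *\<^sub>R i) = lborel"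
    (is "distr ?M borel ?f = lborel")
proof (rule lborel_eqI[symmetric])
  interpret product_sigma_finite "\<lambda>_::'v. lborel :: real measure"
    by unfold_locales
  have f[measurable]: "?f \<in> borel_measurable ?M"
    by measurable
  fix l u :: 'p assume le: "\<And>b. b \<in> Basis \<Longrightarrow> l \<bullet> b \<le> u \<bullet> b"
  let ?j = "inv_into Basis \<iota>"
  have "?f -` box l u \<inter> space ?M = (\<Pi>\<^sub>E b\<in>\<iota> ` Basis. {l \<bullet> ?j b <..< u \<bullet> ?j b})"
    using inj by (auto simp: space_PiM PiE_iff box_def)
  then have "emeasure (distr ?M borel ?f) (box l u) =
      emeasure ?M (\<Pi>\<^sub>E b\<in>\<iota> ` Basis. {l \<bullet> ?j b <..< u \<bullet> ?j b})"
    by (simp add: emeasure_distr)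
  also have "\<dots> = (\<Prod>b\<in>\<iota> ` Basis. emeasure lborel {l \<bullet> ?j b <..< u \<bullet> ?j b})"
    by (rule emeasure_PiM) auto
  also have "\<dots> = (\<Prod>i\<in>Basis. ennreal ((u - l) \<bullet> i))"
    by (subst prod.reindex[OF inj]) (auto intro!: prod.cong simp: inj le inner_diff_left)
  also have "\<dots> = ennreal (\<Prod>i\<in>Basis. (u - l) \<bullet> i)"
    by (rule prod_ennreal) (simp add: le inner_diff_left)
  finally show "emeasure (distr ?M borel ?f) (box l u) = (\<Prod>i\<in>Basis. (u - l) \<bullet> i)" .
qed simp

lemma full_lebesgue_measure_in_coordinates:
  fixes \<iota> :: "'p::euclidean_space \<Rightarrow> 'v::real_vector"
  assumes \<iota>: "linear \<iota>" "bij_betw \<iota> UNIV P" and N: "negligible N"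
    and A: "\<And>p. p \<notin> N \<Longrightarrow> \<iota> p \<in> A"
  shows "full_lebesgue_measure_in P A"
  unfolding full_lebesgue_measure_in_def
proof (intro exI[of _ "\<iota> ` Basis"] conjI)
  have inj: "inj \<iota>" and range: "range \<iota> = P"
    using \<iota>(2) by (auto simp: bij_betw_def)
  have injB: "inj_on \<iota> Basis"
    using inj inj_on_subset by blast
  show "independent (\<iota> ` Basis)"
    by (rule linear_independent_injective_image[OF \<iota>(1) independent_Basis]) (use inj in simp)
  show "span (\<iota> ` Basis) = P"
    using linear_span_image[OF \<iota>(1), of Basis] range by simp
  \<comment> \<open>The set \<open>N\<close> need not be Borel; a Borel null set around it lets the
    statement pass through the image measure.\<close>
  obtain N' where N': "N' \<in> null_sets lborel" "N \<subseteq> N'"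
    using N unfolding negligible_iff_null_sets null_sets_completion_iff2 by blast
  have "AE p in lborel. p \<notin> N'"
    using N'(1) by (rule AE_not_in)
  then have "AE p in distr (Pi\<^sub>M (\<iota> ` Basis) (\<lambda>_. lborel)) borel (\<lambda>c. \<Sum>i\<in>Basis. c (\<iota> i) *\<^sub>R i). p \<notin> N'"
    unfolding distr_PiM_lborel_coordinates[OF injB] .
  then have "AE c in Pi\<^sub>M (\<iota> ` Basis) (\<lambda>_. lborel). (\<Sum>i\<in>Basis. c (\<iota> i) *\<^sub>R i) \<notin> N'"
    by (rule AE_distrD[rotated]) measurable
  then show "AE c in Pi\<^sub>M (\<iota> ` Basis) (\<lambda>_. lborel). (\<Sum>b\<in>\<iota> ` Basis. c b *\<^sub>R b) \<in> A"
  proof eventually_elim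
    case (elim c)
    then have "\<iota> (\<Sum>i\<in>Basis. c (\<iota> i) *\<^sub>R i) \<in> A"
      using A N'(2) by blast
    moreover have "\<iota> (\<Sum>i\<in>Basis. c (\<iota> i) *\<^sub>R i) = (\<Sum>b\<in>\<iota> ` Basis. c b *\<^sub>R b)"
      by (simp add: linear_sum[OF \<iota>(1)] linear_scale[OF \<iota>(1)] sum.reindex[OF injB])
    ultimately show ?case by simp
  qed
qed simp

lemma C1_on_imp_continuous_on:
  assumes "C1_on S f"
  shows "continuous_on S f"
proof -
  obtain f' where "\<forall>x\<in>S. (f has_derivative blinfun_apply (f' x)) (at x within S)"
    using assms unfolding C1_on_def by blast
  then show ?thesis
    by (intro has_derivative_continuous_on[of S f "\<lambda>x. blinfun_apply (f' x)"]) blast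
qed

section \<open>Finitely many outcomes for prevalent fields\<close>

theorem proposition4p10:
  fixes X :: "'a::euclidean_space set"
    and \<Q> :: "('a \<Rightarrow> 'a) set"
    and d\<Q> :: "('a \<Rightarrow> 'a) \<Rightarrow> ('a \<Rightarrow> 'a) \<Rightarrow> real"
    and \<tau> :: "('a \<Rightarrow> 'a) \<Rightarrow> 'a \<Rightarrow> ereal"
    and G :: "('a \<Rightarrow> 'a) \<Rightarrow> 'a \<Rightarrow> real \<Rightarrow> 'a"
    and n :: "'a \<Rightarrow> 'a"
    and P :: "('a \<Rightarrow> 'a) set"
    and \<iota> :: "'p::euclidean_space \<Rightarrow> 'a \<Rightarrow> 'a"
  assumes X: "closed X" "convex X" "interior X \<noteq> {}"
    and \<Q>_space: "complete_metric_vector_space \<Q> d\<Q>"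
    \<comment> \<open>functions on \<open>X\<close> are represented by their extensions by zero\<close>
    and \<Q>_on_X: "\<forall>Q\<in>\<Q>. \<forall>x. x \<notin> X \<longrightarrow> Q x = 0"
    and \<Q>_C1: "\<forall>Q\<in>\<Q>. C1_on X Q"
    and flow: "\<forall>Q\<in>\<Q>. well_behaved_flow X Q (\<tau> Q) (G Q)"
    and boundary: "C2_boundary X"
    and zeros: "\<forall>Q\<in>\<Q>. \<exists>K1 K2. compact K1 \<and> K1 \<subseteq> X \<and> compact K2 \<and> K2 \<subseteq> frontier X \<and>
                  {x \<in> X. Q x = 0} \<subseteq> K1 \<and> {x \<in> frontier X. projected_field X Q x = 0} \<subseteq> K2"
    and normal: "\<forall>x\<in>frontier X. outward_unit_normal X x (n x)"
    and P: "fin_dim_subspace P \<Q>"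
    \<comment> \<open>linear coordinates on \<open>P\<close>, giving it its structure as a finite-dimensional normed space\<close>
    and coords: "linear \<iota>" "bij_betw \<iota> UNIV P"
    and submersion_interior: "\<forall>Q\<in>\<Q>.
          C1_submersion_on (UNIV \<times> X) (\<lambda>_. UNIV)
            (\<lambda>(p, x). (Q + \<iota> p) x)"
    and submersion_boundary: "\<forall>Q\<in>\<Q>.
          C1_submersion_on (UNIV \<times> frontier X \<times> {0..})
            (\<lambda>(p, x, \<alpha>). UNIV \<times> {v. v \<bullet> n x = 0} \<times> UNIV)
            (\<lambda>(p, x, \<alpha>::real). (Q + \<iota> p) x - \<alpha> *\<^sub>R n x)"
  shows "prevalent_in \<Q> {Q \<in> \<Q>. finite (dynamic_solver X (\<tau> Q) (G Q) ` X)}"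
proof -
  have sub\<Q>: "subspace \<Q>"
    using \<Q>_space by (simp add: complete_metric_vector_space_def)
  have P\<Q>: "P \<subseteq> \<Q>"
    using P by (simp add: fin_dim_subspace_def)
  have \<iota>\<Q>: "Q + \<iota> p \<in> \<Q>" if "Q \<in> \<Q>" for Q p
  proof -
    have "\<iota> p \<in> P" using coords(2) by (auto simp: bij_betw_def)
    then show ?thesis using that P\<Q> sub\<Q> by (blast intro: subspace_add)
  qed
  have frontierX: "frontier X \<subseteq> X"
    by (rule frontier_subset_closed[OF X(1)])
  \<comment> \<open>The given \<open>P\<close> serves as the probe space of prevalence, so for each
    fixed \<open>Q\<close> a null set of bad parameters is sought.\<close>
  have "full_lebesgue_measure_in P {p \<in> P. Q + p \<in> {Q \<in> \<Q>. finite (dynamic_solver X (\<tau> Q) (G Q) ` X)}}"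
    if Q: "Q \<in> \<Q>" for Q
  proof -
    define f where "f = (\<lambda>(p, x). (Q + \<iota> p) x)"
    obtain f' :: "'p \<times> 'a \<Rightarrow> ('p \<times> 'a) \<Rightarrow>\<^sub>L 'a" where
      f': "\<And>z. z \<in> UNIV \<times> X \<Longrightarrow> (f has_derivative blinfun_apply (f' z)) (at z within UNIV \<times> X)"
        "\<And>z. z \<in> UNIV \<times> X \<Longrightarrow> surj (blinfun_apply (f' z))"
      using submersion_interior Q unfolding C1_submersion_on_def f_def by blast
    let ?Z = "{z \<in> UNIV \<times> X. f z = 0}"
    \<comment> \<open>On its zero set \<open>f\<close> agrees with the constant 0, so its derivative
      restricts to a derivative of the zero function.\<close>
    have derZ: "((\<lambda>_. 0) has_derivative blinfun_apply (f' z)) (at z within ?Z)" if "z \<in> ?Z" for z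
    proof (rule has_derivative_transform[OF that])
      show "(f has_derivative blinfun_apply (f' z)) (at z within ?Z)"
        by (rule has_derivative_subset[OF f'(1)]) (use that in auto)
    qed simp
    have surjZ: "surj (blinfun_apply (f' z))" if "z \<in> ?Z" for z
      using that f'(2) by blast
    have "\<exists>N. negligible N \<and> (\<forall>p T. p \<notin> N \<and> compact T \<and> {p} \<times> T \<subseteq> ?Z \<longrightarrow> finite T)"
      by (rule generic_compact_slices_finite[OF refl derZ surjZ])
    then obtain N where N: "negligible N"
      "\<forall>p T. p \<notin> N \<and> compact T \<and> {p} \<times> T \<subseteq> ?Z \<longrightarrow> finite T"
      by (elim exE conjE) (rule that)

    define g where "g = (\<lambda>(p, x, \<alpha>::real). (Q + \<iota> p) x - \<alpha> *\<^sub>R n x)"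
    define M :: "('p \<times> 'a \<times> real) set" where "M = UNIV \<times> frontier X \<times> {0..}"
    obtain g' :: "'p \<times> 'a \<times> real \<Rightarrow> ('p \<times> 'a \<times> real) \<Rightarrow>\<^sub>L 'a" where
      g': "\<And>z. z \<in> M \<Longrightarrow> (g has_derivative blinfun_apply (g' z)) (at z within M)"
        "\<And>z. z \<in> M \<Longrightarrow>
           blinfun_apply (g' z) ` (\<lambda>(p, x, \<alpha>::real). UNIV \<times> {v. v \<bullet> n x = 0} \<times> UNIV) z = UNIV"
      using submersion_boundary Q unfolding C1_submersion_on_def g_def M_def by blast
    \<comment> \<open>The second component cuts out the tangent space of \<open>frontier X\<close>, which makes the dimensions
      of the fibre variable \<open>(x, \<alpha>)\<close> and of the target agree.\<close>
    define A :: "'p \<times> 'a \<times> real \<Rightarrow> 'p \<times> 'a \<times> real \<Rightarrow> 'a \<times> real"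
      where "A = (\<lambda>z h. (blinfun_apply (g' z) h, n (fst (snd z)) \<bullet> fst (snd h)))"
    let ?W = "{z \<in> M. g z = 0}"
    have derW: "((\<lambda>_. 0) has_derivative A z) (at z within ?W)" if z: "z \<in> ?W" for z
    proof -
      have "((\<lambda>_. 0) has_derivative blinfun_apply (g' z)) (at z within ?W)"
      proof (rule has_derivative_transform[OF z])
        show "(g has_derivative blinfun_apply (g' z)) (at z within ?W)"
          by (rule has_derivative_subset[OF g'(1)]) (use z in auto)
      qed simp
      moreover have "((\<lambda>_. 0) has_derivative (\<lambda>h. n (fst (snd z)) \<bullet> fst (snd h))) (at z within ?W)"
      proof (rule has_derivative_in_compose[where f = "\<lambda>z. fst (snd z)" and g = "\<lambda>_. 0"])
        show "((\<lambda>z. fst (snd z)) has_derivative (\<lambda>h. fst (snd h))) (at z within ?W)"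
          by (intro has_derivative_fst has_derivative_snd has_derivative_ident)
        have x: "fst (snd z) \<in> frontier X"
          using z by (auto simp: M_def)
        show "((\<lambda>_. 0) has_derivative (\<bullet>) (n (fst (snd z))))
            (at (fst (snd z)) within (\<lambda>z. fst (snd z)) ` ?W)"
          by (rule has_derivative_subset[OF has_derivative_normal_frontier[OF _ X(1) x]])
            (use normal x in \<open>auto simp: M_def\<close>)
      qed
      ultimately show ?thesis
        unfolding A_def zero_prod_def by (rule has_derivative_Pair)
    qed
    have surjW: "surj (A z)" if z: "z \<in> ?W" for z
    proof -
      obtain p x \<alpha> where z_eq: "z = (p, x, \<alpha>)" by (metis prod_cases3)
      have zM: "z \<in> M" and x: "x \<in> frontier X"
        using z by (auto simp: M_def z_eq)
      have nx: "n x \<bullet> n x = 1"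
        using normal x by (simp add: outward_unit_normal_def dot_square_norm)
      have "\<exists>h. A z h = (b, r)" for b r
      proof -
        \<comment> \<open>The normal part \<open>k\<close> produces the second component
          \<open>r\<close>; a tangential vector \<open>h\<close> then corrects the first without
          changing it.\<close>
        define k :: "'p \<times> 'a \<times> real" where "k = (0, r *\<^sub>R n x, 0)"
        have "b - blinfun_apply (g' z) k \<in> blinfun_apply (g' z) ` (UNIV \<times> {v. v \<bullet> n x = 0} \<times> UNIV)"
          using g'(2)[OF zM] by (simp add: z_eq)
        then obtain h where h: "fst (snd h) \<bullet> n x = 0" "blinfun_apply (g' z) h = b - blinfun_apply (g' z) k"
          by auto
        have "A z (h + k) = (b, r)"
          using h nx by (simp add: A_def k_def z_eq blinfun.add_right inner_add_right inner_commute)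
        then show ?thesis ..
      qed
      then show ?thesis
        unfolding surj_def by (metis surj_pair)
    qed
    have "\<exists>N. negligible N \<and> (\<forall>p T. p \<notin> N \<and> compact T \<and> {p} \<times> T \<subseteq> ?W \<longrightarrow> finite T)"
      by (rule generic_compact_slices_finite[OF refl derW surjW])
    then obtain N' where N': "negligible N'"
      "\<forall>p T. p \<notin> N' \<and> compact T \<and> {p} \<times> T \<subseteq> ?W \<longrightarrow> finite T"
      by (elim exE conjE) (rule that)

    have "finite (dynamic_solver X (\<tau> (Q + \<iota> p)) (G (Q + \<iota> p)) ` X)" if p: "p \<notin> N \<union> N'" for p
    proof -
      define R where "R = Q + \<iota> p"
      have R: "R \<in> \<Q>" unfolding R_def by (rule \<iota>\<Q>[OF Q])
      obtain K1 K2 where K1: "compact K1" "{x \<in> X. R x = 0} \<subseteq> K1"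
        and K2: "compact K2" "K2 \<subseteq> frontier X" "{x \<in> frontier X. projected_field X R x = 0} \<subseteq> K2"
        using bspec[OF zeros R] by (elim exE conjE) (rule that)
      have contR: "continuous_on X R"
        by (rule C1_on_imp_continuous_on[OF bspec[OF \<Q>_C1 R]])
      define E where "E = {x \<in> X. R x = 0}"
      have "closed E"
        unfolding E_def by (rule continuous_closed_preimage_constant[OF contR X(1)])
      then have "compact E"
        using K1 compact_Int_closed[of K1 E] by (simp add: E_def Int_absorb1)
      moreover have "{p} \<times> E \<subseteq> ?Z"
        by (auto simp: E_def f_def R_def)
      ultimately have finE: "finite E"
        using N(2) p by blast
      \<comment> \<open>The bound \<open>m\<close> on \<open>R\<close> over \<open>K2\<close>
        confines the multiplier of a boundary equilibrium to \<open>[0, m]\<close>, which makes the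
        set \<open>F\<close> of pairs compact.\<close>
      have "compact (R ` K2)"
        using K2 frontierX contR by (meson compact_continuous_image continuous_on_subset order_trans)
      then obtain m where m: "\<And>x. x \<in> K2 \<Longrightarrow> norm (R x) \<le> m"
        using compact_imp_bounded bounded_iff by (metis imageI)
      define F where "F = {y \<in> K2 \<times> {0..m}. g (p, y) = 0}"
      have K2M: "Pair p ` (K2 \<times> {0..m}) \<subseteq> M"
        using K2(2) by (auto simp: M_def)
      have "continuous_on M g"
        using g'(1) by (rule has_derivative_continuous_on)
      then have "continuous_on (K2 \<times> {0..m}) (\<lambda>y. g (p, y))"
        by (rule continuous_on_compose2[OF _ _ K2M]) (intro continuous_intros)
      moreover have compK: "compact (K2 \<times> {0..m})"
        using K2(1) by (intro compact_Times) auto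
      ultimately have "closed F"
        unfolding F_def by (intro continuous_closed_preimage_constant compact_imp_closed)
      then have "compact F"
        using compK compact_Int_closed[of "K2 \<times> {0..m}" F] by (simp add: F_def Int_absorb1 Collect_conj_eq)
      moreover have "{p} \<times> F \<subseteq> ?W"
        using K2M by (auto simp: F_def)
      ultimately have finF: "finite F"
        using N'(2) p by blast
      have "dynamic_solver X (\<tau> R) (G R) ` X \<subseteq> insert None (Some ` (E \<union> fst ` F))"
      proof safe
        fix x0 assume x0: "x0 \<in> X"
        assume "dynamic_solver X (\<tau> R) (G R) x0 \<notin> Some ` (E \<union> fst ` F)"
        moreover have "Lim at_top (G R x0) \<in> E \<union> fst ` F"
          if inf: "\<tau> R x0 = \<infinity>" and l: "l \<in> X" "(G R x0 \<longlongrightarrow> l) at_top" for l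
        proof -
          have lim: "Lim at_top (G R x0) = l"
            using l(2) by (intro tendsto_Lim) auto
          have zero: "projected_field X R l = 0"
            by (rule limit_is_equilibrium[OF bspec[OF flow R] x0 inf l])
          show ?thesis
          \<comment> \<open>An interior equilibrium is a zero of \<open>R\<close>; a boundary one
            has \<open>R l\<close> equal to \<open>norm (R l)\<close> times the normal, so this norm
            is the multiplier paired with \<open>l\<close> in \<open>F\<close>.\<close>
          proof (cases "l \<in> interior X")
            case True
            then show ?thesis
              using zero projected_field_interior[OF True, of R] l(1) lim by (simp add: E_def)
          next
            case False
            then have fr: "l \<in> frontier X"
              using l(1) X(1) by (simp add: frontier_def)
            then have "l \<in> K2" using zero K2(3) by blast
            moreover have "R l = norm (R l) *\<^sub>R n l"
              using normal fr l(1) zero by (intro frontier_equilibrium_normal) auto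
            ultimately have "(l, norm (R l)) \<in> F"
              using m by (simp add: F_def g_def R_def)
            then show ?thesis
              using lim by force
          qed
        qed
        ultimately show "dynamic_solver X (\<tau> R) (G R) x0 = None"
          unfolding dynamic_solver_def by (auto split: if_splits)
      qed
      then show ?thesis
        unfolding R_def[symmetric] by (rule finite_subset) (simp add: finE finF)
    qed
    then have "\<iota> p \<in> {p \<in> P. Q + p \<in> {Q \<in> \<Q>. finite (dynamic_solver X (\<tau> Q) (G Q) ` X)}}"
      if "p \<notin> N \<union> N'" for p
      using that \<iota>\<Q>[OF Q] coords(2) by (auto simp: bij_betw_def)
    then show ?thesis
      using coords N(1) N'(1) by (intro full_lebesgue_measure_in_coordinates[of \<iota> P "N \<union> N'"]) auto
  qed
  then show ?thesis
    unfolding prevalent_in_def using P by blast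
qed

end
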